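(* Let $G$ be a group such that the derived subgroup $G'$ of $G$ is infinite cyclic. Then $G$ is a UT-group.
   Context: For a group $G$, $\mathcal{U}_1(\mathbb{Z}G)$ denotes the group of units of augmentation one of the integral group ring $\mathbb{Z}G$. For $\alpha=\sum_{h\in G}\alpha(h)h\in\mathbb{Z}G$ and $g\in G$, let $C_g$ be the conjugacy class of $g$ in $G$ and set $\tilde{\alpha}(g)=\sum_{h\in C_g}\alpha(h)$. A unit $\alpha\in\mathcal{U}_1(\mathbb{Z}G)$ has the unique trace property if there exists an element $g\in G$, unique up to conjugacy in $G$, such that $\tilde{\alpha}(g)\neq 0$. A group $G$ is a UT-group (has the UT-property) if every element of finite order of $\mathcal{U}_1(\mathbb{Z}G)$ has the unique trace property. *)

theory Defs
  imports "HOL-Algebra.Generated_Groups" "HOL-Algebra.Free_Abelian_Groups" "HOL-Algebra.Ring"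
begin

section \<open>The integral group ring\<close>

text \<open>
  An element of the group ring is a finitely supported function from the group to the integers.
  Since \<^const>\<open>frag_extend\<close> is the linear extension of a map on basis elements, the product below
  is the convolution product, i.e. the bilinear extension of the multiplication of \<open>G\<close>.
\<close>

definition integral_group_ring :: "('a, 'm) monoid_scheme \<Rightarrow> ('a \<Rightarrow>\<^sub>0 int) ring" where
  "integral_group_ring G =
     \<lparr>carrier = {\<alpha>. Poly_Mapping.keys \<alpha> \<subseteq> carrier G},
      mult = (\<lambda>\<alpha> \<beta>. frag_extend (\<lambda>g. frag_extend (\<lambda>h. frag_of (g \<otimes>\<^bsub>G\<^esub> h)) \<beta>) \<alpha>),
      one = frag_of \<one>\<^bsub>G\<^esub>,
      zero = 0,
      add = (+)\<rparr>"

definition augmentation :: "('a \<Rightarrow>\<^sub>0 int) \<Rightarrow> int" where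
  "augmentation \<alpha> = (\<Sum>g\<in>Poly_Mapping.keys \<alpha>. Poly_Mapping.lookup \<alpha> g)"

definition normalized_units :: "('a, 'm) monoid_scheme \<Rightarrow> ('a \<Rightarrow>\<^sub>0 int) monoid" where
  "normalized_units G =
     (units_of (integral_group_ring G))
       \<lparr>carrier := {\<alpha> \<in> Units (integral_group_ring G). augmentation \<alpha> = 1}\<rparr>"

section \<open>The unique trace property\<close>

definition conjugacy_class :: "('a, 'm) monoid_scheme \<Rightarrow> 'a \<Rightarrow> 'a set" where
  "conjugacy_class G g = {x \<otimes>\<^bsub>G\<^esub> g \<otimes>\<^bsub>G\<^esub> inv\<^bsub>G\<^esub> x |x. x \<in> carrier G}"

text \<open>
  Conjugacy classes may be infinite, and sums over infinite sets are \<open>0\<close> by convention;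
  hence the restriction of the summation to the finite support of \<open>\<alpha>\<close>.
\<close>

definition partial_augmentation :: "('a, 'm) monoid_scheme \<Rightarrow> ('a \<Rightarrow>\<^sub>0 int) \<Rightarrow> 'a \<Rightarrow> int" where
  "partial_augmentation G \<alpha> g =
     (\<Sum>h\<in>conjugacy_class G g \<inter> Poly_Mapping.keys \<alpha>. Poly_Mapping.lookup \<alpha> h)"

definition unique_trace :: "('a, 'm) monoid_scheme \<Rightarrow> ('a \<Rightarrow>\<^sub>0 int) \<Rightarrow> bool" where
  "unique_trace G \<alpha> \<longleftrightarrow>
     (\<exists>g\<in>carrier G. partial_augmentation G \<alpha> g \<noteq> 0 \<and>
        (\<forall>h\<in>carrier G. partial_augmentation G \<alpha> h \<noteq> 0 \<longrightarrow> h \<in> conjugacy_class G g))"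

definition UT_group :: "('a, 'm) monoid_scheme \<Rightarrow> bool" where
  "UT_group G \<longleftrightarrow> group G \<and>
     (\<forall>\<alpha>\<in>carrier (normalized_units G).
        (\<exists>n::nat. n > 0 \<and> \<alpha> [^]\<^bsub>normalized_units G\<^esub> n = \<one>\<^bsub>normalized_units G\<^esub>)
          \<longrightarrow> unique_trace G \<alpha>)"

section \<open>The structures above are a ring and a group\<close>

lemma frag_extend_fun_add:
  "frag_extend (\<lambda>g. f g + f' g) \<alpha> = frag_extend f \<alpha> + frag_extend f' \<alpha>"
  by (simp add: frag_extend_def frag_cmul_distrib2 sum.distrib)

context
  fixes G (structure)
  assumes G: "group G"
begin

interpretation group G by (rule G)

abbreviation (input) gmult where
  "gmult \<alpha> \<beta> \<equiv> frag_extend (\<lambda>g. frag_extend (\<lambda>h. frag_of (g \<otimes> h)) \<beta>) \<alpha>"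

lemma gmult_closed:
  assumes "Poly_Mapping.keys \<alpha> \<subseteq> carrier G" "Poly_Mapping.keys \<beta> \<subseteq> carrier G"
  shows "Poly_Mapping.keys (gmult \<alpha> \<beta>) \<subseteq> carrier G"
proof -
  have 1: "Poly_Mapping.keys (frag_extend (\<lambda>h. frag_of (g \<otimes> h)) \<beta>) \<subseteq> carrier G" if "g \<in> carrier G" for g
    using assms(2) that by (intro order.trans[OF keys_frag_extend]) auto
  show ?thesis
    using assms(1) 1 by (intro order.trans[OF keys_frag_extend]) blast
qed

lemma gmult_assoc:
  assumes "Poly_Mapping.keys \<alpha> \<subseteq> carrier G" "Poly_Mapping.keys \<beta> \<subseteq> carrier G"
    "Poly_Mapping.keys \<gamma> \<subseteq> carrier G"
  shows "gmult (gmult \<alpha> \<beta>) \<gamma> = gmult \<alpha> (gmult \<beta> \<gamma>)"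
  using assms(1)
proof (induction \<alpha> rule: frag_induction)
  case (one x)
  then have x: "x \<in> carrier G" by simp
  show ?case
    using assms(2)
  proof (induction \<beta> rule: frag_induction)
    case (one y)
    then have y: "y \<in> carrier G" by simp
    show ?case
      using assms(3) by (induction \<gamma> rule: frag_induction) (auto simp: frag_extend_diff m_assoc x y)
  qed (auto simp: frag_extend_diff)
qed (auto simp: frag_extend_diff)

lemma ring_integral_group_ring: "ring (integral_group_ring G)"
proof (rule ringI)
  show "abelian_group (integral_group_ring G)"
  proof (rule abelian_groupI)
    fix x assume "x \<in> carrier (integral_group_ring G)"
    then show "\<exists>y\<in>carrier (integral_group_ring G). y \<oplus>\<^bsub>integral_group_ring G\<^esub> x = \<zero>\<^bsub>integral_group_ring G\<^esub>"
      by (intro bexI[of _ "- x"]) (auto simp: integral_group_ring_def)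
  qed (use keys_add in \<open>force simp: integral_group_ring_def\<close>)+
  show "monoid (integral_group_ring G)"
  proof (rule monoidI)
    fix x assume "x \<in> carrier (integral_group_ring G)"
    then have x: "Poly_Mapping.keys x \<subseteq> carrier G" by (simp add: integral_group_ring_def)
    show "\<one>\<^bsub>integral_group_ring G\<^esub> \<otimes>\<^bsub>integral_group_ring G\<^esub> x = x"
      unfolding integral_group_ring_def using x
      by simp (induction x rule: frag_induction, auto simp: frag_extend_diff)
    show "x \<otimes>\<^bsub>integral_group_ring G\<^esub> \<one>\<^bsub>integral_group_ring G\<^esub> = x"
      unfolding integral_group_ring_def using x
      by simp (induction x rule: frag_induction, auto simp: frag_extend_diff)
  qed (auto simp: integral_group_ring_def gmult_assoc intro: subsetD[OF gmult_closed])
qed (auto simp: integral_group_ring_def frag_extend_add frag_extend_fun_add)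

lemma augmentation_eq_sum:
  "finite A \<Longrightarrow> Poly_Mapping.keys \<alpha> \<subseteq> A \<Longrightarrow> augmentation \<alpha> = (\<Sum>g\<in>A. Poly_Mapping.lookup \<alpha> g)"
  unfolding augmentation_def by (rule sum.mono_neutral_left) (auto simp: in_keys_iff)

lemma augmentation_diff: "augmentation (\<alpha> - \<beta>) = augmentation \<alpha> - augmentation \<beta>"
proof -
  let ?A = "Poly_Mapping.keys \<alpha> \<union> Poly_Mapping.keys \<beta>"
  have "augmentation (\<alpha> - \<beta>) = (\<Sum>g\<in>?A. Poly_Mapping.lookup (\<alpha> - \<beta>) g)"
    using keys_diff[of \<alpha> \<beta>] by (intro augmentation_eq_sum) auto
  moreover have "augmentation \<alpha> = (\<Sum>g\<in>?A. Poly_Mapping.lookup \<alpha> g)"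
    "augmentation \<beta> = (\<Sum>g\<in>?A. Poly_Mapping.lookup \<beta> g)"
    by (intro augmentation_eq_sum; auto)+
  ultimately show ?thesis by (simp add: lookup_minus sum_subtractf)
qed

lemma augmentation_zero: "augmentation 0 = 0"
  by (simp add: augmentation_def)

lemma augmentation_of: "augmentation (frag_of g) = 1"
  by (simp add: augmentation_def)

lemma augmentation_gmult: "augmentation (gmult \<alpha> \<beta>) = augmentation \<alpha> * augmentation \<beta>"
  using subset_UNIV[of "Poly_Mapping.keys \<alpha>"]
proof (induction \<alpha> rule: frag_induction)
  case (one x)
  show ?case
    using subset_UNIV[of "Poly_Mapping.keys \<beta>"]
    by (induction \<beta> rule: frag_induction)
      (auto simp: frag_extend_diff augmentation_diff augmentation_zero augmentation_of)
qed (auto simp: frag_extend_diff augmentation_diff augmentation_zero algebra_simps)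

lemma group_normalized_units: "group (normalized_units G)"
proof -
  interpret R: ring "integral_group_ring G" by (rule ring_integral_group_ring)
  interpret U: group "units_of (integral_group_ring G)" by (rule R.units_group)
  have aug_mult: "augmentation (x \<otimes>\<^bsub>integral_group_ring G\<^esub> y) = augmentation x * augmentation y" for x y
    by (simp add: integral_group_ring_def augmentation_gmult)
  have aug_one: "augmentation \<one>\<^bsub>integral_group_ring G\<^esub> = 1"
    by (simp add: integral_group_ring_def augmentation_of)
  have "subgroup {\<alpha> \<in> Units (integral_group_ring G). augmentation \<alpha> = 1} (units_of (integral_group_ring G))"
  proof (rule U.subgroupI)
    fix a assume a: "a \<in> {\<alpha> \<in> Units (integral_group_ring G). augmentation \<alpha> = 1}"
    then have "a \<otimes>\<^bsub>integral_group_ring G\<^esub> inv\<^bsub>integral_group_ring G\<^esub> a = \<one>\<^bsub>integral_group_ring G\<^esub>" by simp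
    then have "augmentation (inv\<^bsub>integral_group_ring G\<^esub> a) = 1"
      using a aug_mult[of a "inv\<^bsub>integral_group_ring G\<^esub> a"] aug_one by simp
    then show "inv\<^bsub>units_of (integral_group_ring G)\<^esub> a \<in> {\<alpha> \<in> Units (integral_group_ring G). augmentation \<alpha> = 1}"
      using a by (simp add: R.units_of_inv)
  qed (use aug_one in \<open>auto simp: units_of_carrier units_of_mult aug_mult\<close>)
  then show ?thesis
    unfolding normalized_units_def by (rule U.subgroup_imp_group)
qed

end

end

theory Submission
  imports Defs "HOL-Number_Theory.Residues"
begin

text \<open>
  Let \<open>\<alpha>\<^sup>n = 1\<close>. For a conjugation-invariant set \<open>U\<close> let \<open>\<epsilon>\<^sub>U(\<alpha>)\<close> be the sum of the coefficients
  of \<open>\<alpha>\<close> on \<open>U\<close>, and let \<open>U\<^sub>m = {g. g\<^sup>m \<in> U}\<close>. Rotating words of prime length \<open>p\<close> gives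
  \<open>\<epsilon>\<^sub>U(\<alpha>\<^sup>p) \<equiv> \<epsilon>\<^sub>U\<^sub>p(\<alpha>)\<close> modulo \<open>p\<close>. The powers of \<open>\<alpha>\<close> are finitely many, so both sides are bounded and
  the congruence is an equality for large \<open>p\<close>; iterating, \<open>\<epsilon>\<^sub>U(\<alpha>\<^sup>m) = \<epsilon>\<^sub>U\<^sub>m(\<alpha>)\<close> whenever all prime
  factors of \<open>m\<close> are large. Two choices of \<open>m\<close> are used. With \<open>m \<equiv> 1\<close> modulo \<open>n\<close> one finds
  that partial augmentations vanish on elements of infinite order (if \<open>g\<^sup>a \<sim> g\<^sup>b\<close>, \<open>0 < a < b\<close>, forces
  \<open>g\<close> to be torsion). If the group is abelian, \<open>m \<equiv> -1\<close> modulo \<open>n\<close> and the orders of the support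
  gives \<open>\<alpha>\<^sup>-\<^sup>1 = \<alpha>\<^sup>*\<close>, so the squares of the coefficients of \<open>\<alpha>\<close> add up to \<open>1\<close> (Higman's theorem).

  Now let \<open>G' = \<langle>z\<rangle>\<close> be infinite cyclic. By Higman's theorem for \<open>G/G'\<close>, exactly one coset of \<open>G'\<close>
  has nonzero total coefficient, so it suffices that every coset \<open>G'g\<close> contains at most one class
  with nonzero partial augmentation. If \<open>g\<close> centralises \<open>z\<close>, then \<open>G'g\<close> contains at most one torsion
  element. If \<open>g\<close> inverts \<open>z\<close>, then \<open>G'g\<close> is a single class: its class contains \<open>\<langle>z\<^sup>2\<rangle>g\<close>, and were
  it no larger, then \<open>G = \<langle>z\<rangle>C(g)\<close> with \<open>C(g)\<close> abelian, whence \<open>G' \<subseteq> \<langle>z\<^sup>2\<rangle>\<close>.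
\<close>

section \<open>Sums over orbits of prime length\<close>

text \<open>An orbit of \<open>f\<close> in \<open>X\<close> has 1 or \<open>p\<close> elements and
  \<open>F\<close> is constant on it, so every orbit that is not a fixed point contributes a
  multiple of \<open>p\<close>. The induction removes one such orbit at a time.\<close>

lemma sum_cong_sum_fixed_points:
  fixes F :: "'b \<Rightarrow> int"
  assumes p: "prime p" and "finite X" and "\<And>x. x \<in> X \<Longrightarrow> f x \<in> X"
    and "\<And>x. x \<in> X \<Longrightarrow> (f ^^ p) x = x" and "\<And>x. x \<in> X \<Longrightarrow> F (f x) = F x"
  shows "[sum F X = sum F {x \<in> X. f x = x}] (mod int p)"
  using assms(2-)
proof (induction X rule: finite_psubset_induct)
  case (psubset X)
  show ?case
  proof (cases "\<forall>x\<in>X. f x = x")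
    case True
    then have "{x \<in> X. f x = x} = X" by auto
    then show ?thesis by simp
  next
    case False
    then obtain x where x: "x \<in> X" "f x \<noteq> x" by blast
    have p1: "p > 1" using p prime_gt_1_nat by blast
    have px: "(f ^^ p) x = x" using psubset.prems x by blast
    have iter: "(f ^^ k) x \<in> X \<and> F ((f ^^ k) x) = F x" for k
      by (induction k) (use x psubset.prems in auto)
    \<comment> \<open>Some multiple of \<open>d\<close> is 1 modulo \<open>p\<close>, so a period
      \<open>d\<close> would already make \<open>x\<close> a fixed point.\<close>
    have per: "(f ^^ d) x \<noteq> x" if "0 < d" "d < p" for d
    proof
      assume d: "(f ^^ d) x = x"
      have "coprime d p"
        using that p by (metis coprime_commute nat_dvd_not_less prime_imp_coprime)
      then obtain k where "[d * k = 1] (mod p)" using cong_solve_coprime_nat by auto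
      then have "(d * k) mod p = 1" using p1 by (simp add: cong_def)
      then have "(f ^^ (d * k)) x = f x"
        using funpow_mod_eq[OF px, of "d * k"] by simp
      moreover have "(f ^^ (d * k)) x = x"
        using funpow_mod_eq[OF d, of "d * k"] by simp
      ultimately show False using x by simp
    qed
    \<comment> \<open>On the orbit of \<open>x\<close>, \<open>f ^^ (p - i)\<close> undoes
      \<open>f ^^ i\<close>; this stands in for an inverse of \<open>f\<close>.\<close>
    have shift: "(f ^^ (p - i)) ((f ^^ j) x) = (f ^^ (j - i)) x" if "i \<le> j" "i < p" for i j
    proof -
      have "p - i + j = p + (j - i)" using that by simp
      then have "(f ^^ (p - i)) ((f ^^ j) x) = (f ^^ (j - i + p)) x"
        by (metis add.commute comp_apply funpow_add)
      then show ?thesis by (simp add: funpow_add px)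
    qed
    let ?O = "(\<lambda>i. (f ^^ i) x) ` {..<p}"
    have ne: "(f ^^ i) x \<noteq> (f ^^ j) x" if "i < j" "j < p" for i j
      using shift[of i j] shift[of i i] per[of "j - i"] that by auto
    have inj: "inj_on (\<lambda>i. (f ^^ i) x) {..<p}"
      unfolding inj_on_def by (metis lessThan_iff ne not_less_iff_gr_or_eq)
    have O_X: "?O \<subseteq> X" using iter by auto
    have O_all: "(f ^^ k) x \<in> ?O" for k
      using funpow_mod_eq[OF px, of k] p1 by (intro image_eqI[of _ _ "k mod p"]) auto
    have sumO: "sum F ?O = int p * F x"
      by (simp add: sum.reindex[OF inj] iter)
    have nofix: "f y \<noteq> y" if "y \<in> ?O" for y
    proof
      assume fy: "f y = y"
      from that obtain i where i: "i < p" "y = (f ^^ i) x" by auto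
      then have "(f ^^ Suc i) x = (f ^^ i) x" using fy by simp
      then show False using shift[of i "Suc i"] shift[of i i] x i by simp
    qed
    \<comment> \<open>If \<open>f y\<close> lay in the orbit of \<open>x\<close>, so would
      \<open>y = (f ^^ (p - 1)) (f y)\<close>.\<close>
    have closed: "f y \<in> X - ?O" if y: "y \<in> X - ?O" for y
    proof
      show "f y \<in> X" using y psubset.prems by blast
      show "f y \<notin> ?O"
      proof
        assume "f y \<in> ?O"
        then obtain i where "f y = (f ^^ i) x" by auto
        then have "(f ^^ (p - 1)) (f y) = (f ^^ (p - 1 + i)) x" by (simp add: funpow_add)
        moreover have "(f ^^ (p - 1)) (f y) = (f ^^ p) y"
          using p1 by (metis Suc_diff_1 comp_apply funpow_Suc_right order_less_trans zero_less_one)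
        moreover have "(f ^^ p) y = y" using y psubset.prems by blast
        ultimately show False using O_all y by force
      qed
    qed
    have "x \<in> ?O" using p1 by (intro image_eqI[of _ _ 0]) auto
    then have "X - ?O \<subset> X" using x by blast
    then have "[sum F (X - ?O) = sum F {y \<in> X - ?O. f y = y}] (mod int p)"
      by (rule psubset.IH) (use closed psubset.prems in auto)
    moreover have "{y \<in> X - ?O. f y = y} = {y \<in> X. f y = y}" using nofix by auto
    moreover have "sum F X = sum F (X - ?O) + int p * F x"
      using sum.subset_diff[OF O_X psubset.hyps(1), of F] sumO by simp
    ultimately show ?thesis by (simp add: cong_def)
  qed
qed

lemma fermat_int:
  fixes a :: int
  assumes "prime p"
  shows "[a ^ p = a] (mod int p)"
proof (cases "int p dvd a")
  case True
  moreover have "p > 0" using assms prime_gt_0_nat by blast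
  ultimately show ?thesis
    by (metis cong_0_iff cong_sym cong_trans dvd_power dvd_trans)
next
  case False
  \<comment> \<open>Since \<open>a\<close> may be negative, the argument passes to its natural
    representative modulo \<open>p\<close>.\<close>
  define b where "b = nat (a mod int p)"
  have p0: "p > 0" using assms prime_gt_0_nat by blast
  have b: "[int b = a] (mod int p)" using p0 by (simp add: b_def cong_def)
  then have "\<not> p dvd b" using False by (metis cong_dvd_iff int_dvd_int_iff cong_sym)
  then have "[b ^ (p - 1) = 1] (mod p)" using fermat_theorem assms by blast
  then have "[b ^ (p - 1) * b = 1 * b] (mod p)" by (rule cong_scalar_right)
  then have "[b ^ p = b] (mod p)" using power_minus_mult[OF p0, of b] by (metis mult_1)
  then have "[int b ^ p = int b] (mod int p)" by (metis cong_int_iff of_nat_power)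
  then show ?thesis using b by (meson cong_pow cong_sym cong_trans)
qed

section \<open>Coefficient sums over sets\<close>

definition set_augmentation :: "'a set \<Rightarrow> ('a \<Rightarrow>\<^sub>0 int) \<Rightarrow> int" where
  "set_augmentation U \<alpha> = (\<Sum>g\<in>U \<inter> Poly_Mapping.keys \<alpha>. Poly_Mapping.lookup \<alpha> g)"

text \<open>One finite index set shared by several elements lets their sums be compared term by
  term.\<close>

lemma set_augmentation_eq_sum:
  assumes "finite A" "Poly_Mapping.keys \<alpha> \<subseteq> A"
  shows "set_augmentation U \<alpha> = (\<Sum>g\<in>A. if g \<in> U then Poly_Mapping.lookup \<alpha> g else 0)"
proof -
  have "set_augmentation U \<alpha> = (\<Sum>g\<in>A \<inter> U. Poly_Mapping.lookup \<alpha> g)"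
    unfolding set_augmentation_def using assms
    by (intro sum.mono_neutral_left) (auto simp: in_keys_iff)
  then show ?thesis using assms by (simp add: sum.inter_restrict)
qed

lemma set_augmentation_0 [simp]: "set_augmentation U 0 = 0"
  by (simp add: set_augmentation_def)

lemma set_augmentation_add:
  "set_augmentation U (\<alpha> + \<beta>) = set_augmentation U \<alpha> + set_augmentation U \<beta>"
proof -
  let ?A = "Poly_Mapping.keys \<alpha> \<union> Poly_Mapping.keys \<beta>"
  have "set_augmentation U \<gamma> = (\<Sum>g\<in>?A. if g \<in> U then Poly_Mapping.lookup \<gamma> g else 0)"
    if "\<gamma> \<in> {\<alpha>, \<beta>, \<alpha> + \<beta>}" for \<gamma>
    using that keys_add[of \<alpha> \<beta>] by (intro set_augmentation_eq_sum) auto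
  then show ?thesis
    by (simp add: Poly_Mapping.lookup_add flip: sum.distrib) (rule sum.cong, auto simp: Poly_Mapping.lookup_add)
qed

lemma set_augmentation_frag_cmul:
  "set_augmentation U (frag_cmul c \<alpha>) = c * set_augmentation U \<alpha>"
  using set_augmentation_eq_sum[OF _ keys_cmul, of \<alpha> U c] set_augmentation_eq_sum[of "Poly_Mapping.keys \<alpha>" \<alpha> U]
  by (auto simp: sum_distrib_left intro!: sum.cong)

lemma set_augmentation_frag_of [simp]: "set_augmentation U (frag_of g) = of_bool (g \<in> U)"
  by (simp add: set_augmentation_def)

lemma set_augmentation_sum:
  "set_augmentation U (sum f A) = (\<Sum>x\<in>A. set_augmentation U (f x))"
  by (induction A rule: infinite_finite_induct) (auto simp: set_augmentation_add)

lemma set_augmentation_frag_extend: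
  "set_augmentation U (frag_extend f \<alpha>) =
    (\<Sum>g\<in>Poly_Mapping.keys \<alpha>. Poly_Mapping.lookup \<alpha> g * set_augmentation U (f g))"
  by (simp add: frag_extend_def set_augmentation_sum set_augmentation_frag_cmul)

lemma set_augmentation_Diff:
  "V \<subseteq> U \<Longrightarrow> set_augmentation U \<alpha> = set_augmentation V \<alpha> + set_augmentation (U - V) \<alpha>"
  by (auto simp: set_augmentation_eq_sum[of "Poly_Mapping.keys \<alpha>"] simp flip: sum.distrib intro!: sum.cong)

lemma set_augmentation_singleton: "set_augmentation {g} \<alpha> = Poly_Mapping.lookup \<alpha> g"
  by (simp add: set_augmentation_eq_sum[of "insert g (Poly_Mapping.keys \<alpha>)"] subset_insertI)

text \<open>The bound is uniform in \<open>U\<close>, so that one threshold for primes serves all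
  conjugation-invariant sets.\<close>

lemma abs_set_augmentation_le:
  "\<bar>set_augmentation U \<alpha>\<bar> \<le> (\<Sum>g\<in>Poly_Mapping.keys \<alpha>. \<bar>Poly_Mapping.lookup \<alpha> g\<bar>)"
  unfolding set_augmentation_def
  by (rule order.trans[OF sum_abs]) (rule sum_mono2, auto)

lemma partial_augmentation_eq:
  "partial_augmentation G \<alpha> g = set_augmentation (conjugacy_class G g) \<alpha>"
  by (simp add: partial_augmentation_def set_augmentation_def)

lemma rotate1_eq_imp_replicate:
  "rotate1 xs = xs \<Longrightarrow> length xs = Suc n \<Longrightarrow> \<exists>x. xs = replicate (Suc n) x"
  by (metis One_nat_def card_1_singletonE length_0_conv nat.distinct(1) replicate_length_same
      rotate1_fixpoint_card singletonD)

lemma (in monoid) pow_mult_add_if_pow_eq_one: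
  fixes n k j :: nat
  assumes "x \<in> carrier G" "x [^] n = \<one>"
  shows "x [^] (n * k + j) = x [^] j"
  using assms by (simp flip: nat_pow_mult nat_pow_pow)

section \<open>Products and powers in the group ring as sums over words\<close>

context group
begin

abbreviation (input) R where "R \<equiv> integral_group_ring G"

lemma set_augmentation_mult:
  "set_augmentation U (\<alpha> \<otimes>\<^bsub>R\<^esub> \<beta>) =
    (\<Sum>x\<in>Poly_Mapping.keys \<alpha>. Poly_Mapping.lookup \<alpha> x * set_augmentation {y. x \<otimes> y \<in> U} \<beta>)"
proof -
  have "set_augmentation U (frag_extend (\<lambda>h. frag_of (x \<otimes> h)) \<beta>) = set_augmentation {y. x \<otimes> y \<in> U} \<beta>" for x
    by (simp add: set_augmentation_frag_extend set_augmentation_eq_sum[of "Poly_Mapping.keys \<beta>" \<beta>]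
        if_distrib of_bool_def cong: if_cong)
  then show ?thesis
    by (simp add: integral_group_ring_def set_augmentation_frag_extend)
qed

definition words :: "'a set \<Rightarrow> nat \<Rightarrow> 'a list set" where
  "words A n = {xs. set xs \<subseteq> A \<and> length xs = n}"

text \<open>Multiplying out gives one term per word over the support. The induction keeps
  \<open>U\<close> arbitrary because cutting off the first letter \<open>x\<close> replaces
  \<open>U\<close> by \<open>{y. x \<otimes> y \<in> U}\<close>.\<close>

lemma set_augmentation_pow:
  assumes "Poly_Mapping.keys \<alpha> \<subseteq> carrier G"
  shows "set_augmentation U (\<alpha> [^]\<^bsub>R\<^esub> n) =
    (\<Sum>xs\<in>words (Poly_Mapping.keys \<alpha>) n.
      if foldr (\<otimes>) xs \<one> \<in> U then prod_list (map (Poly_Mapping.lookup \<alpha>) xs) else 0)"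
proof (induction n arbitrary: U)
  case 0
  have "words (Poly_Mapping.keys \<alpha>) 0 = {[]}" by (auto simp: words_def)
  then show ?case by (simp add: integral_group_ring_def)
next
  case (Suc n)
  let ?K = "Poly_Mapping.keys \<alpha>"
  interpret R: ring R by (rule ring_integral_group_ring[OF is_group])
  have \<alpha>: "\<alpha> \<in> carrier R" using assms by (simp add: integral_group_ring_def)
  have W: "words ?K (Suc n) = (\<lambda>(x, xs). x # xs) ` (?K \<times> words ?K n)"
    by (force simp: words_def length_Suc_conv)
  have "set_augmentation U (\<alpha> [^]\<^bsub>R\<^esub> Suc n) = set_augmentation U (\<alpha> \<otimes>\<^bsub>R\<^esub> \<alpha> [^]\<^bsub>R\<^esub> n)"
    using R.nat_pow_Suc2[OF \<alpha>] by simp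
  also have "\<dots> = (\<Sum>x\<in>?K. \<Sum>xs\<in>words ?K n. if x \<otimes> foldr (\<otimes>) xs \<one> \<in> U
      then Poly_Mapping.lookup \<alpha> x * prod_list (map (Poly_Mapping.lookup \<alpha>) xs) else 0)"
    by (auto simp: set_augmentation_mult Suc.IH sum_distrib_left intro!: sum.cong)
  also have "\<dots> = (\<Sum>xs\<in>words ?K (Suc n).
      if foldr (\<otimes>) xs \<one> \<in> U then prod_list (map (Poly_Mapping.lookup \<alpha>) xs) else 0)"
    unfolding W by (subst sum.reindex) (auto simp: inj_on_def sum.cartesian_product intro!: sum.cong)
  finally show ?case .
qed

section \<open>Coefficient sums of powers\<close>

definition conj_closed :: "'a set \<Rightarrow> bool" where
  "conj_closed U \<longleftrightarrow> U \<subseteq> carrier G \<and> (\<forall>x\<in>carrier G. \<forall>u\<in>U. x \<otimes> u \<otimes> inv x \<in> U)"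

lemma inv_mult_cancel_left:
  assumes "x \<in> carrier G" "y \<in> carrier G"
  shows "inv x \<otimes> (x \<otimes> y) = y" "x \<otimes> (inv x \<otimes> y) = y"
  using assms by (simp_all flip: m_assoc)

lemma conj_pow:
  assumes "x \<in> carrier G" "g \<in> carrier G"
  shows "(x \<otimes> g \<otimes> inv x) [^] (n::nat) = x \<otimes> g [^] n \<otimes> inv x"
proof (induction n)
  case (Suc n)
  have "x \<otimes> g [^] n \<otimes> inv x \<otimes> (x \<otimes> g \<otimes> inv x) = x \<otimes> (g [^] n \<otimes> g) \<otimes> inv x"
    using assms by (simp add: m_assoc inv_mult_cancel_left)
  then show ?case using Suc by simp
qed (use assms in simp)

lemma conj_closed_vimage_pow:
  "conj_closed U \<Longrightarrow> conj_closed {g \<in> carrier G. g [^] (n::nat) \<in> U}"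
  by (auto simp: conj_closed_def conj_pow)

lemma foldr_mult_carrier:
  "set xs \<subseteq> carrier G \<Longrightarrow> foldr (\<otimes>) xs \<one> \<in> carrier G"
  by (induction xs) auto

lemma foldr_mult_append:
  "set xs \<subseteq> carrier G \<Longrightarrow> a \<in> carrier G \<Longrightarrow> foldr (\<otimes>) xs a = foldr (\<otimes>) xs \<one> \<otimes> a"
  by (induction xs) (auto simp: m_assoc foldr_mult_carrier)

lemma funpow_mult_one:
  "x \<in> carrier G \<Longrightarrow> ((\<otimes>) x ^^ n) \<one> = x [^] n"
  by (induction n) (simp_all only: funpow.simps comp_apply nat_pow_Suc2 nat_pow_0 id_apply)

text \<open>Moving the first letter \<open>x\<close> to the end conjugates the product by
  \<open>inv x\<close>.\<close>

lemma foldr_mult_rotate1: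
  assumes "conj_closed U" "set xs \<subseteq> carrier G" "foldr (\<otimes>) xs \<one> \<in> U"
  shows "foldr (\<otimes>) (rotate1 xs) \<one> \<in> U"
proof (cases xs)
  case (Cons x ys)
  then have x: "x \<in> carrier G" and ys: "set ys \<subseteq> carrier G" using assms(2) by auto
  let ?P = "foldr (\<otimes>) ys \<one>"
  have P: "?P \<in> carrier G" using ys by (rule foldr_mult_carrier)
  have "foldr (\<otimes>) (rotate1 xs) \<one> = inv x \<otimes> (x \<otimes> ?P) \<otimes> inv (inv x)"
    using x P foldr_mult_append[OF ys, of x] by (simp add: Cons inv_mult_cancel_left)
  moreover have "x \<otimes> ?P \<in> U" using assms(3) Cons by simp
  ultimately show ?thesis using assms(1) x by (metis conj_closed_def inv_closed)
qed (use assms in simp)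

text \<open>Rotation acts on the words of length \<open>p\<close> with product in \<open>U\<close>
  and preserves the product of coefficients. The fixed words are the constant ones, which contribute
  \<open>p\<close>-th powers of coefficients; Fermat's little theorem removes the exponent.\<close>

lemma set_augmentation_pow_prime_cong:
  assumes p: "prime p" and U: "conj_closed U" and \<alpha>: "Poly_Mapping.keys \<alpha> \<subseteq> carrier G"
  shows "[set_augmentation U (\<alpha> [^]\<^bsub>R\<^esub> p) =
    set_augmentation {g \<in> carrier G. g [^] p \<in> U} \<alpha>] (mod int p)"
proof -
  let ?K = "Poly_Mapping.keys \<alpha>"
  let ?F = "\<lambda>xs. prod_list (map (Poly_Mapping.lookup \<alpha>) xs)"
  define X where "X = {xs \<in> words ?K p. foldr (\<otimes>) xs \<one> \<in> U}"
  have W: "finite (words ?K p)" by (simp add: words_def finite_lists_length_eq)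
  have p0: "p > 0" using p prime_gt_0_nat by blast
  have "set_augmentation U (\<alpha> [^]\<^bsub>R\<^esub> p) = sum ?F X"
    using W by (simp add: set_augmentation_pow[OF \<alpha>] X_def sum.inter_filter)
  also have "[sum ?F X = sum ?F {xs \<in> X. rotate1 xs = xs}] (mod int p)"
  proof (rule sum_cong_sum_fixed_points[OF p])
    show "finite X" using W by (simp add: X_def)
    show "rotate1 xs \<in> X" if "xs \<in> X" for xs
      using that foldr_mult_rotate1[OF U, of xs] \<alpha> by (auto simp: X_def words_def)
    show "(rotate1 ^^ p) xs = xs" if "xs \<in> X" for xs
      using that by (simp add: X_def words_def flip: rotate_def)
    show "?F (rotate1 xs) = ?F xs" for xs
      by (cases xs) auto
  qed
  also have "{xs \<in> X. rotate1 xs = xs} = replicate p ` {x \<in> ?K. x [^] p \<in> U}"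
  proof (intro equalityI subsetI)
    fix xs assume xs: "xs \<in> {xs \<in> X. rotate1 xs = xs}"
    then obtain x where x: "xs = replicate p x"
      using rotate1_eq_imp_replicate[of xs "p - 1"] p0 by (auto simp: X_def words_def)
    with xs p0 have "x \<in> ?K" by (auto simp: X_def words_def)
    moreover from this have "x [^] p \<in> U"
      using xs x \<alpha> by (auto simp: X_def funpow_mult_one subset_iff)
    ultimately show "xs \<in> replicate p ` {x \<in> ?K. x [^] p \<in> U}"
      using x by blast
  next
    fix xs assume "xs \<in> replicate p ` {x \<in> ?K. x [^] p \<in> U}"
    then show "xs \<in> {xs \<in> X. rotate1 xs = xs}"
      using \<alpha> by (auto simp: X_def words_def funpow_mult_one)
  qed
  also have "sum ?F (replicate p ` {x \<in> ?K. x [^] p \<in> U}) =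
      (\<Sum>x\<in>{x \<in> ?K. x [^] p \<in> U}. Poly_Mapping.lookup \<alpha> x ^ p)"
    using p0 by (subst sum.reindex) (auto simp: inj_on_def prod_list_replicate)
  also have "[\<dots> = (\<Sum>x\<in>{x \<in> ?K. x [^] p \<in> U}. Poly_Mapping.lookup \<alpha> x)] (mod int p)"
    by (intro cong_sum fermat_int p)
  also have "(\<Sum>x\<in>{x \<in> ?K. x [^] p \<in> U}. Poly_Mapping.lookup \<alpha> x) =
      set_augmentation {g \<in> carrier G. g [^] p \<in> U} \<alpha>"
    unfolding set_augmentation_def using \<alpha> by (intro sum.cong) auto
  finally show ?thesis .
qed

text \<open>The congruence modulo \<open>p\<close> is an equality once \<open>p\<close> exceeds
  twice a common bound of both sides. An exponent without small prime factors is then treated one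
  prime at a time.\<close>

theorem set_augmentation_pow_eq:
  assumes \<alpha>: "Poly_Mapping.keys \<alpha> \<subseteq> carrier G" and n: "n > (0::nat)" "\<alpha> [^]\<^bsub>R\<^esub> n = \<one>\<^bsub>R\<^esub>"
  shows "\<exists>M::nat. \<forall>m U. m > 0 \<longrightarrow> (\<forall>p. prime p \<longrightarrow> p dvd m \<longrightarrow> p > M) \<longrightarrow> conj_closed U \<longrightarrow>
    set_augmentation U (\<alpha> [^]\<^bsub>R\<^esub> m) = set_augmentation {g \<in> carrier G. g [^] m \<in> U} \<alpha>"
proof -
  interpret R: ring R by (rule ring_integral_group_ring[OF is_group])
  have \<alpha>R: "\<alpha> \<in> carrier R" using \<alpha> by (simp add: integral_group_ring_def)
  have keys: "Poly_Mapping.keys (\<alpha> [^]\<^bsub>R\<^esub> k) \<subseteq> carrier G" for k :: nat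
    using R.nat_pow_closed[OF \<alpha>R, of k] by (simp add: integral_group_ring_def)
  define L :: "('a \<Rightarrow>\<^sub>0 int) \<Rightarrow> int"
    where "L = (\<lambda>\<beta>. \<Sum>g\<in>Poly_Mapping.keys \<beta>. \<bar>Poly_Mapping.lookup \<beta> g\<bar>)"
  \<comment> \<open>The powers of \<alpha> repeat with period \<open>n\<close>, so this sum bounds
    the l^1 norm \<open>L\<close> of all of them.\<close>
  define M where "M = (\<Sum>k<n. L (\<alpha> [^]\<^bsub>R\<^esub> k))"
  have L0: "L \<beta> \<ge> 0" for \<beta> by (simp add: L_def sum_nonneg)
  have LM: "L (\<alpha> [^]\<^bsub>R\<^esub> k) \<le> M" for k :: nat
  proof -
    have "\<alpha> [^]\<^bsub>R\<^esub> k = \<alpha> [^]\<^bsub>R\<^esub> (k mod n)"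
      using R.pow_mult_add_if_pow_eq_one[OF \<alpha>R n(2), of "k div n" "k mod n"] by simp
    then show ?thesis unfolding M_def using n(1) L0 by (auto intro: member_le_sum)
  qed
  have bound: "\<bar>set_augmentation U (\<alpha> [^]\<^bsub>R\<^esub> k)\<bar> \<le> M" for U and k :: nat
    using abs_set_augmentation_le LM L_def order_trans by fastforce
  \<comment> \<open>The congruence is applied to \<alpha>^k and not only to \<alpha>, to strip one
    prime from an exponent \<open>k * p\<close>. The two sides differ by at most
    \<open>2 * M\<close>, hence by less than \<open>p\<close>.\<close>
  have prime_step: "set_augmentation U (\<alpha> [^]\<^bsub>R\<^esub> (k * p)) =
      set_augmentation {g \<in> carrier G. g [^] p \<in> U} (\<alpha> [^]\<^bsub>R\<^esub> k)"
    if p: "prime p" "p > nat (2 * M)" and U: "conj_closed U" for p k :: nat and U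
  proof -
    let ?a = "set_augmentation U (\<alpha> [^]\<^bsub>R\<^esub> (k * p))"
    let ?b = "set_augmentation {g \<in> carrier G. g [^] p \<in> U} (\<alpha> [^]\<^bsub>R\<^esub> k)"
    have "[?a = ?b] (mod int p)"
      using set_augmentation_pow_prime_cong[OF p(1) U keys[of k]] by (simp add: R.nat_pow_pow[OF \<alpha>R])
    then have "int p dvd ?a - ?b" by (simp add: cong_iff_dvd_diff)
    moreover have "\<bar>?a - ?b\<bar> < int p"
      using bound[of U "k * p"] bound[of "{g \<in> carrier G. g [^] p \<in> U}" k] p(2) by linarith
    ultimately have "?a - ?b = 0" using dvd_imp_le_int[of "?a - ?b" "int p"] by linarith
    then show ?thesis by simp
  qed
  show ?thesis
  proof (intro exI allI impI)
    fix m :: nat and U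
    assume "m > 0" "\<forall>p. prime p \<longrightarrow> p dvd m \<longrightarrow> p > nat (2 * M)" "conj_closed U"
    then show "set_augmentation U (\<alpha> [^]\<^bsub>R\<^esub> m) = set_augmentation {g \<in> carrier G. g [^] m \<in> U} \<alpha>"
    \<comment> \<open>\<open>U\<close> varies since stripping \<open>p\<close> replaces it by its
      preimage under the \<open>p\<close>-th power map.\<close>
    proof (induction m arbitrary: U rule: less_induct)
      case (less m)
      show ?case
      proof (cases "m = 1")
        case True
        have "set_augmentation U \<alpha> = set_augmentation {g \<in> carrier G. g \<in> U} \<alpha>"
          using \<alpha> by (auto simp: set_augmentation_def intro!: sum.cong)
        then show ?thesis using True \<alpha>R by (simp cong: conj_cong)
      next
        case False
        then obtain p where p: "prime p" "p dvd m" using prime_factor_nat by blast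
        then obtain k where k: "m = k * p" by (metis dvd_def mult.commute)
        have "k > 0" "k < m" using k less.prems(1) p(1) prime_gt_1_nat[of p] by auto
        let ?V = "{g \<in> carrier G. g [^] p \<in> U}"
        have "set_augmentation U (\<alpha> [^]\<^bsub>R\<^esub> m) = set_augmentation ?V (\<alpha> [^]\<^bsub>R\<^esub> k)"
          unfolding k by (rule prime_step) (use p less.prems in auto)
        also have "\<dots> = set_augmentation {g \<in> carrier G. g [^] k \<in> ?V} \<alpha>"
          using \<open>k > 0\<close> \<open>k < m\<close> less.prems k
          by (intro less.IH conj_closed_vimage_pow) auto
        also have "{g \<in> carrier G. g [^] k \<in> ?V} = {g \<in> carrier G. g [^] m \<in> U}"
          by (auto simp: k nat_pow_pow)
        finally show ?thesis .
      qed
    qed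
  qed
qed

end

text \<open>Turns the condition on prime factors into coprimality with \<open>fact M\<close>, which
  any \<open>m\<close> congruent to 1 or -1 modulo \<open>fact M\<close> satisfies.\<close>

lemma prime_factor_gt_if_coprime_fact:
  fixes M :: nat
  assumes "coprime m (fact M)" "prime p" "p dvd m"
  shows "p > M"
  using assms by (metis coprime_common_divisor_nat leI not_prime_unit prime_dvd_fact_iff nat_dvd_1_iff_1)

section \<open>Torsion units\<close>

lemma set_augmentation_nonzeroE:
  assumes "set_augmentation U \<alpha> \<noteq> 0"
  obtains g where "g \<in> U" "g \<in> Poly_Mapping.keys \<alpha>"
  using assms unfolding set_augmentation_def by (metis IntE sum.not_neutral_contains_not_neutral)

context group
begin

section \<open>Conjugacy classes and vanishing of partial augmentations off torsion\<close>

lemma conjugacy_class_trans: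
  assumes "g \<in> carrier G" "h \<in> conjugacy_class G g" "k \<in> conjugacy_class G g"
  shows "k \<in> conjugacy_class G h"
proof -
  obtain x y where x: "x \<in> carrier G" "h = x \<otimes> g \<otimes> inv x" and y: "y \<in> carrier G" "k = y \<otimes> g \<otimes> inv y"
    using assms(2,3) by (auto simp: conjugacy_class_def)
  then have "k = (y \<otimes> inv x) \<otimes> h \<otimes> inv (y \<otimes> inv x)"
    using assms(1) by (simp add: m_assoc inv_mult_group inv_mult_cancel_left)
  then show ?thesis using x y by (auto simp: conjugacy_class_def)
qed

lemma conjugacy_class_self: "g \<in> carrier G \<Longrightarrow> g \<in> conjugacy_class G g"
  unfolding conjugacy_class_def by (force intro: exI[of _ "\<one>"])

lemma conj_closed_conjugacy_class:
  assumes "g \<in> carrier G"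
  shows "conj_closed (conjugacy_class G g)"
proof -
  have "\<exists>z\<in>carrier G. x \<otimes> (y \<otimes> g \<otimes> inv y) \<otimes> inv x = z \<otimes> g \<otimes> inv z"
    if "x \<in> carrier G" "y \<in> carrier G" for x y
    using that assms by (intro bexI[of _ "x \<otimes> y"]) (auto simp: m_assoc inv_mult_group)
  then show ?thesis using assms by (fastforce simp: conj_closed_def conjugacy_class_def)
qed

lemma conj_closed_Diff:
  assumes U: "conj_closed U" and V: "conj_closed V"
  shows "conj_closed (U - V)"
proof -
  have "u \<in> V" if x: "x \<in> carrier G" and u: "u \<in> U" and v: "x \<otimes> u \<otimes> inv x \<in> V" for x u
  proof -
    have "u \<in> carrier G" using u U by (auto simp: conj_closed_def)
    then have "inv x \<otimes> (x \<otimes> u \<otimes> inv x) \<otimes> inv (inv x) = u"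
      using x by (simp add: m_assoc inv_mult_cancel_left)
    then show ?thesis using v x V by (metis conj_closed_def inv_closed)
  qed
  then show ?thesis using U by (auto simp: conj_closed_def)
qed

text \<open>For infinitely many \<open>m\<close> with \<alpha>^m = \<alpha>, some support element
  has its \<open>m\<close>-th power conjugate to \<open>h\<close>. By pigeonhole one element
  \<open>g\<close> serves two exponents, and \<open>pow_conj\<close> makes it torsion. Keeping
  \<open>pow_conj\<close> as a hypothesis lets the lemma serve both abelian groups and the groups of
  the theorem.\<close>

lemma partial_augmentation_nonzero_imp_torsion:
  assumes \<alpha>: "Poly_Mapping.keys \<alpha> \<subseteq> carrier G" and n: "n > (0::nat)" "\<alpha> [^]\<^bsub>R\<^esub> n = \<one>\<^bsub>R\<^esub>"
    and h: "h \<in> carrier G" "partial_augmentation G \<alpha> h \<noteq> 0"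
    and pow_conj: "\<And>g a b. g \<in> carrier G \<Longrightarrow> 0 < a \<Longrightarrow> a < (b::nat) \<Longrightarrow>
      g [^] b \<in> conjugacy_class G (g [^] a) \<Longrightarrow> \<exists>k>0. g [^] (k::nat) = \<one>"
  shows "\<exists>k>0. h [^] (k::nat) = \<one>"
proof -
  interpret R: ring R by (rule ring_integral_group_ring[OF is_group])
  have \<alpha>R: "\<alpha> \<in> carrier R" using \<alpha> by (simp add: integral_group_ring_def)
  let ?U = "conjugacy_class G h"
  have U: "conj_closed ?U" by (rule conj_closed_conjugacy_class[OF h(1)])
  obtain M :: nat where M: "\<forall>(m::nat) U. m > 0 \<longrightarrow> (\<forall>p. prime p \<longrightarrow> p dvd m \<longrightarrow> p > M) \<longrightarrow> conj_closed U \<longrightarrow>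
      set_augmentation U (\<alpha> [^]\<^bsub>R\<^esub> m) = set_augmentation {g \<in> carrier G. g [^] m \<in> U} \<alpha>"
    using set_augmentation_pow_eq[OF \<alpha> n] by blast
  \<comment> \<open>These exponents increase with \<open>c\<close>, are 1 modulo \<open>n\<close>,
    so that \<alpha>^m = \<alpha>, and 1 modulo \<open>fact M\<close>, so that their prime factors
    exceed \<open>M\<close>.\<close>
  define m where "m c = n * (fact M * Suc c) + 1" for c
  have "\<exists>g\<in>Poly_Mapping.keys \<alpha>. g [^] m c \<in> ?U" for c
  proof -
    have "coprime (m c) (fact M)"
      using coprime_add_one_left[of "n * (fact M * Suc c)"]
      by (intro coprime_divisors[of "m c" "m c" "fact M" "n * (fact M * Suc c)"]) (auto simp: m_def)
    then have "set_augmentation ?U (\<alpha> [^]\<^bsub>R\<^esub> m c) = set_augmentation {g \<in> carrier G. g [^] m c \<in> ?U} \<alpha>"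
      by (intro M[rule_format] U) (auto simp: m_def intro: prime_factor_gt_if_coprime_fact)
    moreover have "\<alpha> [^]\<^bsub>R\<^esub> m c = \<alpha>"
      using R.pow_mult_add_if_pow_eq_one[OF \<alpha>R n(2), of "fact M * Suc c" 1] \<alpha>R
      by (simp only: m_def R.nat_pow_eone)
    ultimately have "set_augmentation {g \<in> carrier G. g [^] m c \<in> ?U} \<alpha> \<noteq> 0"
      using h(2) by (simp add: partial_augmentation_eq)
    then show ?thesis by (auto elim: set_augmentation_nonzeroE)
  qed
  then obtain f where f: "\<And>c. f c \<in> Poly_Mapping.keys \<alpha> \<and> f c [^] m c \<in> ?U" by metis
  have "\<not> inj f"
    using f finite_keys[of \<alpha>] by (metis finite_subset image_subsetI range_inj_infinite)
  then obtain c d where cd: "f c = f d" "c < d" unfolding inj_def by (metis linorder_neqE_nat)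
  define g where "g = f c"
  have g: "g \<in> carrier G" using f \<alpha> by (auto simp: g_def)
  have gU: "g [^] m c \<in> ?U" "g [^] m d \<in> ?U" using f[of c] f[of d] cd by (auto simp: g_def)
  have "0 < m c" "m c < m d" using cd(2) n(1) by (auto simp: m_def)
  then obtain k where k: "k > 0" "g [^] (k::nat) = \<one>"
    using pow_conj[OF g _ _ conjugacy_class_trans[OF h(1) gU]] by blast
  obtain x where x: "x \<in> carrier G" "g [^] m c = x \<otimes> h \<otimes> inv x"
    using gU(1) by (auto simp: conjugacy_class_def)
  \<comment> \<open>Torsion passes from \<open>g\<close> to its power \<open>g [^] m c\<close> and
    from there to the conjugate \<open>h\<close>.\<close>
  have "(g [^] m c) [^] k = (g [^] k) [^] m c" using g by (simp add: nat_pow_pow mult.commute)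
  then have "x \<otimes> h [^] k \<otimes> inv x = \<one>" using x h(1) k(2) by (simp add: conj_pow)
  then have "h [^] k = inv x \<otimes> \<one> \<otimes> x" 
    using x(1) h(1) by (metis inv_solve_left inv_solve_right' m_closed nat_pow_closed one_closed r_one m_assoc inv_closed)
  then show ?thesis using k(1) x(1) by auto
qed

end

section \<open>Higman's theorem for abelian groups\<close>

lemma (in comm_group) conjugacy_class_eq:
  assumes "g \<in> carrier G" shows "conjugacy_class G g = {g}"
proof -
  have "x \<otimes> g \<otimes> inv x = g" if "x \<in> carrier G" for x
    using that assms by (simp add: m_comm[of x g] m_assoc)
  then show ?thesis unfolding conjugacy_class_def using one_closed by force
qed

text \<open>A suitable power \<alpha>^m is both the inverse of \<alpha> and its image under
  inversion of group elements; the identity coefficient of the product is then a sum of squares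
  equal to 1.\<close>

theorem (in comm_group) torsion_unit_trivial:
  assumes \<alpha>: "Poly_Mapping.keys \<alpha> \<subseteq> carrier G" and n: "n > (0::nat)" "\<alpha> [^]\<^bsub>R\<^esub> n = \<one>\<^bsub>R\<^esub>"
  shows "\<exists>g\<in>carrier G. Poly_Mapping.keys \<alpha> = {g}"
proof -
  interpret R: ring R by (rule ring_integral_group_ring[OF is_group])
  let ?K = "Poly_Mapping.keys \<alpha>"
  have \<alpha>R: "\<alpha> \<in> carrier R" using \<alpha> by (simp add: integral_group_ring_def)
  have "\<exists>k>0. g [^] (k::nat) = \<one>" if g: "g \<in> ?K" for g
  proof (rule partial_augmentation_nonzero_imp_torsion[OF \<alpha> n])
    show gG: "g \<in> carrier G" using g \<alpha> by blast
    show "partial_augmentation G \<alpha> g \<noteq> 0"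
      using g by (simp add: partial_augmentation_eq conjugacy_class_eq[OF gG] set_augmentation_singleton in_keys_iff)
    fix x and a b :: nat
    assume x: "x \<in> carrier G" "a < b" "x [^] b \<in> conjugacy_class G (x [^] a)"
    then have "x [^] (b - a) = \<one>" using pow_eq_div2[of x b a] by (simp add: conjugacy_class_eq)
    then show "\<exists>k>0. x [^] (k::nat) = \<one>" using x(2) zero_less_diff by blast
  qed
  then obtain ord where ord: "\<And>g. g \<in> ?K \<Longrightarrow> ord g > (0::nat) \<and> g [^] ord g = \<one>" by metis
  define N where "N = prod ord ?K"
  have N: "N > 0" using ord by (simp add: N_def prod_pos)
  obtain M :: nat where M: "\<forall>(m::nat) U. m > 0 \<longrightarrow> (\<forall>p. prime p \<longrightarrow> p dvd m \<longrightarrow> p > M) \<longrightarrow> conj_closed U \<longrightarrow>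
      set_augmentation U (\<alpha> [^]\<^bsub>R\<^esub> m) = set_augmentation {g \<in> carrier G. g [^] m \<in> U} \<alpha>"
    using set_augmentation_pow_eq[OF \<alpha> n] by blast
  \<comment> \<open>\<open>X\<close> is a multiple of \<open>fact M\<close>, \<open>n\<close> and
    all orders of support elements, so \<open>m = X - 1\<close> is -1 modulo each of them. The
    factor 2 keeps \<open>m\<close> positive.\<close>
  define X where "X = fact M * (2 * n * N)"
  have X: "X > 1"
  proof -
    have "fact M * n * N > 0" using n(1) N by simp
    then have "2 * (fact M * n * N) > 1" by linarith
    then show ?thesis by (simp add: X_def mult_ac)
  qed
  define m where "m = X - 1"
  have cop: "coprime m (fact M)"
  proof (rule coprime_divisors[OF dvd_refl])
    show "coprime m X" using coprime_diff_one_left_nat[of X] X by (simp add: m_def)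
  qed (simp add: X_def)
  have inv_pow: "g [^] m = inv g" if g: "g \<in> ?K" for g
  proof -
    have gG: "g \<in> carrier G" using g \<alpha> by blast
    have "ord g dvd X" using g by (simp add: X_def N_def dvd_prodI dvd_mult)
    then have "g [^] X = \<one>" using ord[OF g] gG by (metis dvd_def nat_pow_one nat_pow_pow)
    moreover have "X = Suc m" using X by (simp add: m_def)
    ultimately show ?thesis using gG inv_equality[of "g [^] m" g] by simp
  qed
  have star: "Poly_Mapping.lookup (\<alpha> [^]\<^bsub>R\<^esub> m) (inv h) = Poly_Mapping.lookup \<alpha> h"
    if h: "h \<in> carrier G" for h
  proof -
    have "conj_closed {inv h}"
      using conj_closed_conjugacy_class[of "inv h"] h by (simp add: conjugacy_class_eq)
    then have "set_augmentation {inv h} (\<alpha> [^]\<^bsub>R\<^esub> m) = set_augmentation {g \<in> carrier G. g [^] m \<in> {inv h}} \<alpha>"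
      using X cop by (intro M[rule_format]) (auto simp: m_def intro: prime_factor_gt_if_coprime_fact)
    \<comment> \<open>On the support, \<open>g [^] m = inv g\<close>, so only \<open>h\<close> can
      have \<open>m\<close>-th power \<open>inv h\<close>.\<close>
    also have "\<dots> = set_augmentation {h} \<alpha>"
      unfolding set_augmentation_def
      using \<alpha> h inv_pow inv_inj by (intro sum.cong) (auto simp: inj_on_def subset_iff)
    finally show ?thesis by (simp add: set_augmentation_singleton)
  qed
  have "\<alpha> \<otimes>\<^bsub>R\<^esub> \<alpha> [^]\<^bsub>R\<^esub> m = \<alpha> [^]\<^bsub>R\<^esub> X"
    using R.nat_pow_Suc2[OF \<alpha>R, of m] X by (simp add: m_def)
  also have "\<dots> = \<one>\<^bsub>R\<^esub>"
    using R.pow_mult_add_if_pow_eq_one[OF \<alpha>R n(2), of "fact M * 2 * N" 0] by (simp add: X_def mult_ac)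
  finally have "1 = set_augmentation {\<one>} (\<alpha> \<otimes>\<^bsub>R\<^esub> \<alpha> [^]\<^bsub>R\<^esub> m)"
    by (simp add: integral_group_ring_def)
  \<comment> \<open>The coefficient at the identity pairs \<open>x\<close> with
    \<open>inv x\<close>, where \<alpha>^m has by \<open>star\<close> the coefficient of \<alpha> at
    \<open>x\<close>.\<close>
  also have "\<dots> = (\<Sum>x\<in>?K. Poly_Mapping.lookup \<alpha> x * Poly_Mapping.lookup \<alpha> x)"
    unfolding set_augmentation_mult
  proof (rule sum.cong[OF refl])
    fix x assume "x \<in> ?K"
    then have x: "x \<in> carrier G" using \<alpha> by blast
    have "Poly_Mapping.keys (\<alpha> [^]\<^bsub>R\<^esub> m) \<subseteq> carrier G"
      using R.nat_pow_closed[OF \<alpha>R, of m] by (simp add: integral_group_ring_def)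
    then have "set_augmentation {y. x \<otimes> y \<in> {\<one>}} (\<alpha> [^]\<^bsub>R\<^esub> m) = set_augmentation {inv x} (\<alpha> [^]\<^bsub>R\<^esub> m)"
      unfolding set_augmentation_def using x
      by (intro sum.cong) (auto simp: subset_iff intro: inv_unique'[symmetric] inv_equality[symmetric] simp: m_comm)
    then show "Poly_Mapping.lookup \<alpha> x * set_augmentation {y. x \<otimes> y \<in> {\<one>}} (\<alpha> [^]\<^bsub>R\<^esub> m) =
        Poly_Mapping.lookup \<alpha> x * Poly_Mapping.lookup \<alpha> x"
      by (simp add: set_augmentation_singleton star x)
  qed
  finally have sq: "(\<Sum>x\<in>?K. Poly_Mapping.lookup \<alpha> x * Poly_Mapping.lookup \<alpha> x) = 1" by simp
  have "1 \<le> c * c" if "c \<noteq> 0" for c :: int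
    using that by (metis int_one_le_iff_zero_less not_square_less_zero linorder_neqE_linordered_idom mult_eq_0_iff)
  then have "(\<Sum>x\<in>?K. 1) \<le> (\<Sum>x\<in>?K. Poly_Mapping.lookup \<alpha> x * Poly_Mapping.lookup \<alpha> x)"
    by (intro sum_mono) (simp add: in_keys_iff)
  with sq have "int (card ?K) \<le> 1" by simp
  moreover have "?K \<noteq> {}" using sq by force
  ultimately have "card ?K = 1" by (metis One_nat_def Suc_leI card_gt_0_iff finite_keys le_antisym of_nat_1 of_nat_le_iff)
  then show ?thesis using \<alpha> by (auto simp: card_1_singleton_iff)
qed

text \<open>\<open>F\<close> is the ring homomorphism induced by \<open>h\<close>. Coefficient sums
  of the image are sums over preimages, so for a quotient map a single coefficient becomes a sum
  over a coset.\<close>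

lemma (in group_hom) integral_group_ring_hom:
  defines "F \<equiv> frag_extend (\<lambda>g. frag_of (h g))"
  shows keys_pushforward: "Poly_Mapping.keys \<alpha> \<subseteq> carrier G \<Longrightarrow> Poly_Mapping.keys (F \<alpha>) \<subseteq> carrier H"
    and pushforward_pow: "Poly_Mapping.keys \<alpha> \<subseteq> carrier G \<Longrightarrow>
      F (\<alpha> [^]\<^bsub>integral_group_ring G\<^esub> (n::nat)) = F \<alpha> [^]\<^bsub>integral_group_ring H\<^esub> n"
    and pushforward_one: "F \<one>\<^bsub>integral_group_ring G\<^esub> = \<one>\<^bsub>integral_group_ring H\<^esub>"
    and set_augmentation_pushforward: "set_augmentation U (F \<alpha>) = set_augmentation (h -` U) \<alpha>"
proof -
  interpret R: ring "integral_group_ring G" by (rule ring_integral_group_ring[OF G.is_group])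
  show "Poly_Mapping.keys (F \<alpha>) \<subseteq> carrier H" if "Poly_Mapping.keys \<alpha> \<subseteq> carrier G" for \<alpha>
    unfolding F_def using that by (intro order.trans[OF keys_frag_extend]) auto
  show one: "F \<one>\<^bsub>integral_group_ring G\<^esub> = \<one>\<^bsub>integral_group_ring H\<^esub>"
    by (simp add: F_def integral_group_ring_def)
  have mult: "F (\<alpha> \<otimes>\<^bsub>integral_group_ring G\<^esub> \<beta>) = F \<alpha> \<otimes>\<^bsub>integral_group_ring H\<^esub> F \<beta>"
    if \<alpha>: "Poly_Mapping.keys \<alpha> \<subseteq> carrier G" and \<beta>: "Poly_Mapping.keys \<beta> \<subseteq> carrier G" for \<alpha> \<beta>
    using \<alpha>
  proof (induction \<alpha> rule: frag_induction)
    case (one x)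
    then have x: "x \<in> carrier G" by simp
    show ?case using \<beta>
      by (induction \<beta> rule: frag_induction)
        (auto simp: F_def integral_group_ring_def frag_extend_diff x)
  qed (auto simp: F_def integral_group_ring_def frag_extend_diff)
  show "F (\<alpha> [^]\<^bsub>integral_group_ring G\<^esub> n) = F \<alpha> [^]\<^bsub>integral_group_ring H\<^esub> n"
    if \<alpha>: "Poly_Mapping.keys \<alpha> \<subseteq> carrier G" for \<alpha> and n :: nat
  proof (induction n)
    case (Suc n)
    have "Poly_Mapping.keys (\<alpha> [^]\<^bsub>integral_group_ring G\<^esub> n) \<subseteq> carrier G"
      using R.nat_pow_closed[of \<alpha> n] \<alpha> by (simp add: integral_group_ring_def)
    then show ?case using Suc \<alpha> by (simp add: mult)
  qed (simp add: one)
  show "set_augmentation U (F \<alpha>) = set_augmentation (h -` U) \<alpha>"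
    by (simp add: F_def set_augmentation_frag_extend set_augmentation_eq_sum[of "Poly_Mapping.keys \<alpha>" \<alpha>]
        if_distrib of_bool_def cong: if_cong)
qed

text \<open>The image of \<alpha> over the abelianisation is a torsion unit, so Higman's theorem
  leaves one coset in its support.\<close>

lemma (in group) unique_derived_coset:
  assumes \<alpha>: "Poly_Mapping.keys \<alpha> \<subseteq> carrier G" and n: "n > (0::nat)" "\<alpha> [^]\<^bsub>R\<^esub> n = \<one>\<^bsub>R\<^esub>"
  shows "\<exists>g\<in>carrier G. \<forall>h\<in>carrier G.
    set_augmentation (derived G (carrier G) #> h) \<alpha> \<noteq> 0 \<longleftrightarrow> h \<in> derived G (carrier G) #> g"
proof -
  define D where "D = derived G (carrier G)"
  interpret D: normal D G unfolding D_def by (rule derived_self_is_normal)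
  interpret Q: comm_group "G Mod D" unfolding D_def by (rule derived_quot_is_comm_group)
  interpret \<pi>: group_hom G "G Mod D" "\<lambda>g. D #> g"
    using D.r_coset_hom_Mod by unfold_locales
  let ?\<beta> = "frag_extend (\<lambda>g. frag_of (D #> g)) \<alpha>"
  have "?\<beta> [^]\<^bsub>integral_group_ring (G Mod D)\<^esub> n = \<one>\<^bsub>integral_group_ring (G Mod D)\<^esub>"
    by (simp add: n(2) \<pi>.pushforward_one flip: \<pi>.pushforward_pow[OF \<alpha>])
  then obtain X where X: "X \<in> carrier (G Mod D)" "Poly_Mapping.keys ?\<beta> = {X}"
    using Q.torsion_unit_trivial[OF \<pi>.keys_pushforward[OF \<alpha>] n(1)] by blast
  then obtain g where g: "g \<in> carrier G" "X = D #> g" by (auto simp: FactGroup_def RCOSETS_def)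
  have "set_augmentation (D #> h) \<alpha> \<noteq> 0 \<longleftrightarrow> h \<in> D #> g" if h: "h \<in> carrier G" for h
  proof -
    have eq: "x \<in> D #> h \<longleftrightarrow> D #> x = D #> h" if "x \<in> carrier G" for x
      using that h repr_independence[OF _ h D.subgroup_axioms] rcos_self[OF that D.subgroup_axioms] by metis
    have "set_augmentation (D #> h) \<alpha> = set_augmentation ((\<lambda>g. D #> g) -` {D #> h}) \<alpha>"
      unfolding set_augmentation_def using \<alpha> eq by (intro sum.cong) auto
    also have "\<dots> = Poly_Mapping.lookup ?\<beta> (D #> h)"
      by (simp add: set_augmentation_singleton flip: \<pi>.set_augmentation_pushforward)
    finally have "set_augmentation (D #> h) \<alpha> \<noteq> 0 \<longleftrightarrow> D #> h = X"
      using X(2) by (metis in_keys_iff singleton_iff)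
    also have "\<dots> \<longleftrightarrow> h \<in> D #> g"
      using g h repr_independence[OF _ g(1) D.subgroup_axioms] rcos_self[OF h D.subgroup_axioms] by metis
    finally show ?thesis .
  qed
  then show ?thesis using g(1) unfolding D_def by blast
qed

text \<open>\<open>U\<close> is a disjoint union of classes, so the sum splits into one partial
  augmentation for each class meeting the support.\<close>

lemma (in group) set_augmentation_zero_if_partial_augmentations_zero:
  assumes \<alpha>: "Poly_Mapping.keys \<alpha> \<subseteq> carrier G" and U: "conj_closed U"
    and zero: "\<And>g. g \<in> U \<Longrightarrow> partial_augmentation G \<alpha> g = 0"
  shows "set_augmentation U \<alpha> = 0"
proof -
  let ?K = "U \<inter> Poly_Mapping.keys \<alpha>"
  have "set_augmentation U \<alpha> = (\<Sum>C\<in>conjugacy_class G ` ?K. \<Sum>g\<in>{g \<in> ?K. conjugacy_class G g = C}. Poly_Mapping.lookup \<alpha> g)"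
    unfolding set_augmentation_def by (rule sum.image_gen) simp
  also have "\<dots> = 0"
  proof (rule sum.neutral, rule ballI)
    fix C assume "C \<in> conjugacy_class G ` ?K"
    then obtain h where h: "h \<in> ?K" and C: "C = conjugacy_class G h" by blast
    then have hG: "h \<in> carrier G" using \<alpha> by blast
    have "{g \<in> ?K. conjugacy_class G g = C} = C \<inter> Poly_Mapping.keys \<alpha>"
    proof (intro equalityI subsetI)
      fix g assume "g \<in> {g \<in> ?K. conjugacy_class G g = C}"
      then show "g \<in> C \<inter> Poly_Mapping.keys \<alpha>" using \<alpha> conjugacy_class_self[of g] by auto
    next
      fix g assume g: "g \<in> C \<inter> Poly_Mapping.keys \<alpha>"
      then have gG: "g \<in> carrier G" using \<alpha> by blast
      have "C \<subseteq> U" using h U by (auto simp: C conj_closed_def conjugacy_class_def)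
      moreover have "conjugacy_class G g = C"
      proof (intro equalityI subsetI)
        have hg: "h \<in> conjugacy_class G g"
          using conjugacy_class_trans[OF hG, of g h] conjugacy_class_self[OF hG] g C by blast
        show "x \<in> C" if "x \<in> conjugacy_class G g" for x
          using conjugacy_class_trans[OF gG hg that] by (simp add: C)
        show "x \<in> conjugacy_class G g" if "x \<in> C" for x
          using conjugacy_class_trans[OF hG _ , of g x] g that by (simp add: C)
      qed
      ultimately show "g \<in> {g \<in> ?K. conjugacy_class G g = C}" using g by blast
    qed
    then show "(\<Sum>g\<in>{g \<in> ?K. conjugacy_class G g = C}. Poly_Mapping.lookup \<alpha> g) = 0"
      using zero[of h] h by (simp add: partial_augmentation_def C)
  qed
  finally show ?thesis .
qed

section \<open>Groups with infinite cyclic derived subgroup\<close>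

locale infinite_cyclic_derived = group G for G (structure) +
  fixes z
  assumes z: "z \<in> carrier G"
    and derived_eq: "derived G (carrier G) = range (\<lambda>i::int. z [^] i)"
    and pow_eq_one: "z [^] (i::int) = \<one> \<Longrightarrow> i = 0"
begin

abbreviation "D \<equiv> derived G (carrier G)"

sublocale D: normal D G
  by (rule derived_self_is_normal)

lemma zpow: "z [^] (i::int) \<in> carrier G" using z by simp

lemma zpow_eq_iff: "z [^] (i::int) = z [^] j \<longleftrightarrow> i = j"
proof
  assume "z [^] i = z [^] j"
  then have "z [^] (i - j) = \<one>" using z by (simp add: int_pow_diff)
  then show "i = j" using pow_eq_one by fastforce
qed simp

lemma conj_int_pow:
  assumes "x \<in> carrier G" "g \<in> carrier G"
  shows "(x \<otimes> g \<otimes> inv x) [^] (i::int) = x \<otimes> g [^] i \<otimes> inv x"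
proof (cases i)
  case (nonneg n)
  then show ?thesis using assms by (simp only: int_pow_int conj_pow)
next
  case (neg n)
  then have "(x \<otimes> g \<otimes> inv x) [^] i = inv (x \<otimes> g [^] Suc n \<otimes> inv x)"
    using assms by (simp only: int_pow_neg int_pow_int conj_pow m_closed inv_closed)
  also have "\<dots> = x \<otimes> inv (g [^] Suc n) \<otimes> inv x"
    using assms by (simp add: inv_mult_group m_assoc del: nat_pow_Suc)
  also have "inv (g [^] Suc n) = g [^] i"
    using assms neg by (simp only: int_pow_neg int_pow_int)
  finally show ?thesis .
qed

lemma zpow_pow: "(z [^] (i::int)) [^] (c::nat) = z [^] (i * int c)"
  using z by (metis int_pow_int int_pow_pow)

lemma mem_D: "z [^] (i::int) \<in> D" by (simp add: derived_eq)

text \<open>Conjugation by \<open>x\<close> and by \<open>inv x\<close> sends \<open>z\<close> to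
  powers with exponents \<open>e\<close> and \<open>f\<close>, and composing them gives
  \<open>e * f = 1\<close>. The commutation form allows \<open>x\<close> to be moved past powers of
  \<open>z\<close>.\<close>

lemma conj_generator:
  assumes "x \<in> carrier G"
  obtains e :: int where "e = 1 \<or> e = -1" "\<And>i::int. x \<otimes> z [^] i = z [^] (e * i) \<otimes> x"
proof -
  have ex: "\<exists>e::int. x \<otimes> z \<otimes> inv x = z [^] e" if "x \<in> carrier G" for x
    using D.inv_op_closed2[OF that, of z] mem_D[of 1] z by (auto simp: derived_eq)
  obtain e :: int where e: "x \<otimes> z \<otimes> inv x = z [^] e" using ex assms by blast
  obtain f :: int where f: "inv x \<otimes> z \<otimes> inv (inv x) = z [^] f" using ex[of "inv x"] assms by blast
  have pow: "x \<otimes> z [^] i \<otimes> inv x = z [^] (e * i)" for i :: int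
    using conj_int_pow[OF assms z, of i] z by (simp add: e int_pow_pow)
  have "z [^] (e * f) = x \<otimes> (inv x \<otimes> z \<otimes> inv (inv x)) \<otimes> inv x" by (simp add: f pow)
  also have "\<dots> = z [^] (1::int)" using assms z by (simp add: m_assoc inv_mult_cancel_left)
  finally have "e * f = 1" by (simp only: zpow_eq_iff)
  then have "e = 1 \<or> e = -1" using zmult_eq_1_iff by auto
  moreover have "x \<otimes> z [^] i = z [^] (e * i) \<otimes> x" for i :: int
    using assms zpow by (simp flip: pow add: m_assoc)
  ultimately show thesis by (rule that)
qed

section \<open>Conjugacy inside the cosets of the derived subgroup\<close>

lemma mem_coset_D:
  "h \<in> D #> g \<longleftrightarrow> (\<exists>i::int. h = z [^] i \<otimes> g)"
  by (auto simp: r_coset_def derived_eq)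

lemma conj_mem_coset_D:
  assumes "x \<in> carrier G" "g \<in> carrier G"
  shows "\<exists>i::int. x \<otimes> g \<otimes> inv x = z [^] i \<otimes> g"
proof -
  have "x \<otimes> g \<otimes> inv x \<otimes> inv g \<in> D"
    unfolding derived_def using assms by (intro generate.incl) blast
  then obtain i :: int where "x \<otimes> g \<otimes> inv x \<otimes> inv g = z [^] i" by (auto simp: derived_eq)
  then have "x \<otimes> g \<otimes> inv x = z [^] i \<otimes> g"
    using assms zpow by (simp add: inv_solve_right' inv_solve_right)
  then show ?thesis ..
qed

lemma coset_D_conj_closed:
  assumes "g \<in> carrier G" shows "conj_closed (D #> g)"
  unfolding conj_closed_def
proof (intro conjI ballI)
  show "D #> g \<subseteq> carrier G" using assms zpow by (auto simp: mem_coset_D)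
  fix x h assume x: "x \<in> carrier G" and "h \<in> D #> g"
  then obtain i :: int where h: "h = z [^] i \<otimes> g" by (auto simp: mem_coset_D)
  obtain j :: int where "x \<otimes> h \<otimes> inv x = z [^] j \<otimes> h"
    using conj_mem_coset_D[OF x, of h] assms zpow h by auto
  then have "x \<otimes> h \<otimes> inv x = z [^] (j + i) \<otimes> g"
    using assms zpow z by (simp add: h int_pow_mult m_assoc)
  then show "x \<otimes> h \<otimes> inv x \<in> D #> g" by (auto simp: mem_coset_D)
qed

text \<open>Conjugation changes \<open>g [^] a\<close> by some \<open>z [^] i\<close>, so
  \<open>g [^] (b - a) = z [^] i\<close>. Raising the conjugacy relation to the power
  \<open>b - a\<close> yields \<open>i * b = e * i * a\<close> with \<open>e\<close> the sign by
  which the conjugator acts on \<open>z\<close>; hence \<open>i = 0\<close>.\<close>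

lemma pow_conj_imp_torsion:
  assumes g: "g \<in> carrier G" and ab: "0 < a" "a < (b::nat)"
    and conj: "g [^] b \<in> conjugacy_class G (g [^] a)"
  shows "\<exists>k>0. g [^] (k::nat) = \<one>"
proof -
  obtain x where x: "x \<in> carrier G" "g [^] b = x \<otimes> g [^] a \<otimes> inv x"
    using conj by (auto simp: conjugacy_class_def)
  obtain i :: int where "x \<otimes> g [^] a \<otimes> inv x = z [^] i \<otimes> g [^] a"
    using conj_mem_coset_D[OF x(1), of "g [^] a"] g by auto
  moreover have "g [^] b = g [^] (b - a) \<otimes> g [^] a"
    using g ab by (simp add: nat_pow_mult)
  ultimately have k: "g [^] (b - a) = z [^] i" using x g zpow by simp
  obtain e :: int where e: "e = 1 \<or> e = -1" "\<And>i::int. x \<otimes> z [^] i = z [^] (e * i) \<otimes> x"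
    using conj_generator[OF x(1)] by blast
  have pow: "(g [^] c) [^] (b - a) = z [^] (i * int c)" for c :: nat
  proof -
    have "(g [^] c) [^] (b - a) = (g [^] (b - a)) [^] c" using g by (simp add: nat_pow_pow mult.commute)
    then show ?thesis by (simp only: k zpow_pow)
  qed
  have "z [^] (i * int b) = x \<otimes> z [^] (i * int a) \<otimes> inv x"
    using conj_pow[OF x(1), of "g [^] a" "b - a"] g by (simp add: pow flip: x(2))
  also have "\<dots> = z [^] (e * (i * int a))"
    using x(1) zpow by (simp add: e(2) m_assoc)
  finally have "i * int b = e * (i * int a)" by (simp only: zpow_eq_iff)
  then have "i * (int b - e * int a) = 0" by (simp add: algebra_simps)
  moreover have "int b - e * int a \<noteq> 0" using e(1) ab by auto
  ultimately have "g [^] (b - a) = \<one>" by (simp add: k)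
  then show ?thesis using ab by (intro exI[of _ "b - a"]) simp
qed

text \<open>As \<open>g\<close> commutes with \<open>z\<close>, the power \<open>l * k\<close> of
  the product splits and leaves \<open>z [^] (i * l * k) = \<one>\<close>.\<close>

lemma torsion_unique_in_coset:
  assumes g: "g \<in> carrier G" "g \<otimes> z = z \<otimes> g"
    and tors: "k > 0" "g [^] (k::nat) = \<one>" "l > 0" "(z [^] (i::int) \<otimes> g) [^] (l::nat) = \<one>"
  shows "i = 0"
proof -
  obtain e :: int where e: "\<And>i::int. g \<otimes> z [^] i = z [^] (e * i) \<otimes> g"
    using conj_generator[OF g(1)] by blast
  have "z [^] e \<otimes> g = z [^] (1::int) \<otimes> g" using e[of 1] g z by simp
  then have "e = 1" using g zpow zpow_eq_iff by (metis right_cancel)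
  then have comm: "z [^] i \<otimes> g = g \<otimes> z [^] i" by (simp add: e)
  have "((z [^] i \<otimes> g) [^] l) [^] k = (z [^] i) [^] (l * k) \<otimes> (g [^] k) [^] l"
    using pow_mult_distrib[OF comm zpow g(1), of "l * k"] zpow g(1) by (simp add: nat_pow_pow mult.commute)
  then have "(z [^] i) [^] (l * k) = \<one>" using tors zpow by simp
  then have "z [^] (i * int (l * k)) = \<one>" using z by (metis int_pow_int int_pow_pow)
  then have "i * int (l * k) = 0" by (rule pow_eq_one)
  then show ?thesis using tors by simp
qed

text \<open>\<open>h\<close> inverts \<open>z\<close>, so conjugation by powers of \<open>z\<close>
  shifts exponents by all even numbers. One odd shift is thus enough, and without any the
  commutators would all be even powers of \<open>z\<close>.\<close>

lemma coset_subset_conjugacy_class: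
  assumes h: "h \<in> carrier G" "h \<otimes> z \<noteq> z \<otimes> h"
  shows "D #> h \<subseteq> conjugacy_class G h"
proof -
  obtain e :: int where e: "e = 1 \<or> e = -1" "\<And>i::int. h \<otimes> z [^] i = z [^] (e * i) \<otimes> h"
    using conj_generator[OF h(1)] by blast
  have "e \<noteq> 1" using e(2)[of 1] h z by auto
  with e have hz: "h \<otimes> z [^] i = z [^] (- i) \<otimes> h" for i :: int by auto
  \<comment> \<open>Moving \<open>z [^] (- k)\<close> left past \<open>h\<close> turns it into
    \<open>z [^] k\<close>, which doubles the shift.\<close>
  have shift: "z [^] k \<otimes> (z [^] i \<otimes> h) \<otimes> inv (z [^] k) = z [^] (i + 2 * k) \<otimes> h" for i k :: int
  proof -
    have "z [^] k \<otimes> (z [^] i \<otimes> h) \<otimes> z [^] (- k) = z [^] k \<otimes> z [^] i \<otimes> (h \<otimes> z [^] (- k))"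
      using h zpow by (simp add: m_assoc del: int_pow_neg)
    also have "\<dots> = z [^] k \<otimes> z [^] i \<otimes> z [^] k \<otimes> h"
      using h zpow by (simp add: hz m_assoc del: int_pow_neg)
    also have "\<dots> = z [^] (k + i + k) \<otimes> h"
      using z by (simp only: int_pow_mult)
    also have "k + i + k = i + 2 * k" by simp
    finally show ?thesis using z by (simp only: int_pow_neg)
  qed
  have step: "z [^] (i + 2 * k) \<otimes> h \<in> conjugacy_class G h" if x: "x \<in> carrier G" "x \<otimes> h \<otimes> inv x = z [^] i \<otimes> h"
    for x and i k :: int
  proof -
    have "z [^] (i + 2 * k) \<otimes> h = z [^] k \<otimes> (x \<otimes> h \<otimes> inv x) \<otimes> inv (z [^] k)"
      by (simp only: shift x(2))
    also have "\<dots> = (z [^] k \<otimes> x) \<otimes> h \<otimes> inv (z [^] k \<otimes> x)"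
      using x(1) h zpow by (simp add: m_assoc inv_mult_group)
    finally show ?thesis using x(1) zpow unfolding conjugacy_class_def by blast
  qed
  have "\<exists>x\<in>carrier G. \<exists>i::int. odd i \<and> x \<otimes> h \<otimes> inv x = z [^] i \<otimes> h"
  proof (rule ccontr)
    assume no: "\<not> ?thesis"
    have decomp: "\<exists>k::int. \<exists>c\<in>carrier G. x = z [^] k \<otimes> c \<and> c \<otimes> h = h \<otimes> c" if x: "x \<in> carrier G" for x
    proof -
      obtain i :: int where i: "x \<otimes> h \<otimes> inv x = z [^] i \<otimes> h" using conj_mem_coset_D[OF x h(1)] by blast
      with no x have "even i" by blast
      then obtain k where k: "i = 2 * k" by blast
      \<comment> \<open>Half the exponent is removed: conjugating by \<open>z [^] (- k)\<close>
        cancels the shift \<open>2 * k\<close>, so \<open>c\<close> centralises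
        \<open>h\<close>.\<close>
      define c where "c = z [^] (- k) \<otimes> x"
      have c: "c \<in> carrier G" using x zpow by (simp add: c_def)
      have "c \<otimes> h \<otimes> inv c = z [^] (- k) \<otimes> (x \<otimes> h \<otimes> inv x) \<otimes> inv (z [^] (- k))"
        using x h zpow by (simp add: c_def m_assoc inv_mult_group del: int_pow_neg)
      also have "\<dots> = h" using h by (simp add: i shift k del: int_pow_neg)
      finally have "c \<otimes> h = h \<otimes> c" using c h by (metis inv_solve_right m_closed inv_closed)
      moreover have "x = z [^] k \<otimes> c"
        using x z by (simp add: c_def int_pow_neg inv_mult_cancel_left)
      ultimately show ?thesis using c by blast
    qed
    \<comment> \<open>The centraliser of \<open>h\<close> is abelian: \<open>h\<close> commutes with
      both products of \<open>c\<close> and \<open>d\<close> but inverts the power of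
      \<open>z\<close> by which they differ, so that power is trivial.\<close>
    have central: "c \<otimes> d = d \<otimes> c"
      if c: "c \<in> carrier G" "c \<otimes> h = h \<otimes> c" and d: "d \<in> carrier G" "d \<otimes> h = h \<otimes> d" for c d
    proof -
      obtain i :: int where i: "c \<otimes> d \<otimes> inv c = z [^] i \<otimes> d" using conj_mem_coset_D[OF c(1) d(1)] by blast
      then have cd: "c \<otimes> d = z [^] i \<otimes> (d \<otimes> c)"
        using c(1) d(1) zpow by (metis inv_solve_right m_assoc m_closed)
      have "h \<otimes> (c \<otimes> d) = c \<otimes> d \<otimes> h" "h \<otimes> (d \<otimes> c) = d \<otimes> c \<otimes> h"
        using c d h(1) by (metis m_assoc)+
      moreover have "h \<otimes> (z [^] i \<otimes> (d \<otimes> c)) = z [^] (- i) \<otimes> (h \<otimes> (d \<otimes> c))"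
        using h(1) c(1) d(1) zpow hz[of i] by (metis m_assoc m_closed)
      ultimately have "z [^] (- i) \<otimes> (d \<otimes> c \<otimes> h) = z [^] i \<otimes> (d \<otimes> c \<otimes> h)"
        using h(1) c(1) d(1) zpow by (metis cd m_assoc m_closed)
      then have "z [^] (- i) = z [^] i"
        using h(1) c(1) d(1) zpow by (metis right_cancel m_closed)
      then have "i = 0" by (simp only: zpow_eq_iff)
      then show ?thesis using cd c(1) d(1) by simp
    qed
    let ?E = "range (\<lambda>i::int. z [^] (2 * i))"
    have E: "subgroup ?E G"
    proof (rule subgroupI)
      show "inv a \<in> ?E" if a: "a \<in> ?E" for a
      proof -
        obtain i :: int where "a = z [^] (2 * i)" using a by blast
        then have "inv a = z [^] (2 * (- i))" using z by (simp add: int_pow_neg)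
        then show ?thesis by blast
      qed
      show "a \<otimes> b \<in> ?E" if "a \<in> ?E" "b \<in> ?E" for a b
      proof -
        obtain i j :: int where "a = z [^] (2 * i)" "b = z [^] (2 * j)" using \<open>a \<in> ?E\<close> \<open>b \<in> ?E\<close> by blast
        then have "a \<otimes> b = z [^] (2 * (i + j))" using z by (simp add: int_pow_mult distrib_left)
        then show ?thesis by blast
      qed
    qed (use zpow in auto)
    have "x \<otimes> y \<otimes> inv x \<otimes> inv y \<in> ?E" if x: "x \<in> carrier G" and y: "y \<in> carrier G" for x y
    proof -
      obtain i c where c: "c \<in> carrier G" "c \<otimes> h = h \<otimes> c" "x = z [^] (i::int) \<otimes> c" using decomp[OF x] by blast
      obtain j d where d: "d \<in> carrier G" "d \<otimes> h = h \<otimes> d" "y = z [^] (j::int) \<otimes> d" using decomp[OF y] by blast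
      obtain s :: int where s: "s = 1 \<or> s = -1" "\<And>i::int. c \<otimes> z [^] i = z [^] (s * i) \<otimes> c"
        using conj_generator[OF c(1)] by blast
      obtain t :: int where t: "t = 1 \<or> t = -1" "\<And>i::int. d \<otimes> z [^] i = z [^] (t * i) \<otimes> d"
        using conj_generator[OF d(1)] by blast
      have xy: "x \<otimes> y = z [^] (i + s * j) \<otimes> (c \<otimes> d)"
      proof -
        have "x \<otimes> y = z [^] i \<otimes> (c \<otimes> z [^] j) \<otimes> d" using c d zpow by (simp add: m_assoc)
        also have "\<dots> = z [^] (i + s * j) \<otimes> (c \<otimes> d)" using c(1) d(1) zpow z by (simp add: s(2) int_pow_mult m_assoc)
        finally show ?thesis .
      qed
      have yx: "y \<otimes> x = z [^] (j + t * i) \<otimes> (c \<otimes> d)"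
      proof -
        have "y \<otimes> x = z [^] j \<otimes> (d \<otimes> z [^] i) \<otimes> c" using c d zpow by (simp add: m_assoc)
        also have "\<dots> = z [^] (j + t * i) \<otimes> (d \<otimes> c)" using c(1) d(1) zpow z by (simp add: t(2) int_pow_mult m_assoc)
        finally show ?thesis using central[OF c(1,2) d(1,2)] by simp
      qed
      \<comment> \<open>Signs do not matter modulo 2, so both exponents have the parity of
        \<open>i + j\<close>.\<close>
      have "even (i + s * j - (j + t * i))" using s(1) t(1) by auto
      then obtain k where k: "i + s * j - (j + t * i) = 2 * k" by blast
      have "z [^] (2 * k) \<otimes> (y \<otimes> x) = z [^] (2 * k + (j + t * i)) \<otimes> (c \<otimes> d)"
        using c(1) d(1) z zpow by (simp add: yx int_pow_mult m_assoc)
      also have "\<dots> = x \<otimes> y" using k by (simp add: xy algebra_simps)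
      finally have "x \<otimes> y \<otimes> inv (y \<otimes> x) = z [^] (2 * k)"
        using x y zpow by (metis inv_solve_right' m_closed)
      then have "x \<otimes> y \<otimes> inv x \<otimes> inv y = z [^] (2 * k)"
        using x y by (simp add: inv_mult_group m_assoc)
      then show ?thesis by blast
    qed
    then have "derived_set G (carrier G) \<subseteq> ?E" by blast
    then have "D \<subseteq> ?E" unfolding derived_def using E by (rule generate_subgroup_incl)
    \<comment> \<open>The generator \<open>z\<close> itself lies in \<open>D\<close> and would be an
      even power of \<open>z\<close>.\<close>
    then obtain k :: int where "z [^] (1::int) = z [^] (2 * k)" using mem_D[of 1] by blast
    then have "1 = 2 * k" by (simp only: zpow_eq_iff)
    then show False by presburger
  qed
  then obtain x and i :: int where x: "x \<in> carrier G" "odd i" "x \<otimes> h \<otimes> inv x = z [^] i \<otimes> h" by blast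
  show ?thesis
  proof
    fix g assume "g \<in> D #> h"
    then obtain j :: int where j: "g = z [^] j \<otimes> h" by (auto simp: mem_coset_D)
    show "g \<in> conjugacy_class G h"
    proof (cases "even j")
      case True
      then obtain k where "j = 0 + 2 * k" by auto
      then show ?thesis using step[of \<one> 0 k] h j by simp
    next
      case False
      then have "even (j - i)" using x(2) by simp
      then obtain k where "j = i + 2 * k" by (metis add_diff_cancel_left' diff_add_cancel evenE add.commute)
      then show ?thesis using step[OF x(1,3), of k] j by simp
    qed
  qed
qed

text \<open>Each coset of \<open>D\<close> carries at most one class with nonzero partial
  augmentation, so its coefficient sum detects that class; \<open>unique_derived_coset\<close> then
  singles out one coset.\<close>

lemma unique_trace_if_torsion:
  assumes \<alpha>: "Poly_Mapping.keys \<alpha> \<subseteq> carrier G" and n: "n > (0::nat)" "\<alpha> [^]\<^bsub>R\<^esub> n = \<one>\<^bsub>R\<^esub>"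
  shows "unique_trace G \<alpha>"
proof -
  have same_class: "h \<in> conjugacy_class G g"
    if g: "g \<in> carrier G" "partial_augmentation G \<alpha> g \<noteq> 0" and h: "h \<in> D #> g" "partial_augmentation G \<alpha> h \<noteq> 0"
    for g h
  proof (cases "g \<otimes> z = z \<otimes> g")
    case True
    obtain i :: int where i: "h = z [^] i \<otimes> g" using h(1) by (auto simp: mem_coset_D)
    have hG: "h \<in> carrier G" using i g(1) zpow by simp
    have torsion: "\<exists>k>0. x [^] (k::nat) = \<one>"
      if "x \<in> carrier G" "partial_augmentation G \<alpha> x \<noteq> 0" for x
      by (rule partial_augmentation_nonzero_imp_torsion[OF \<alpha> n that]) (rule pow_conj_imp_torsion)
    obtain k :: nat where k: "k > 0" "g [^] k = \<one>" using torsion[OF g] by blast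
    obtain l :: nat where l: "l > 0" "h [^] l = \<one>" using torsion[OF hG h(2)] by blast
    have "i = 0" by (rule torsion_unique_in_coset[OF g(1) True k l(1)]) (use l(2) i in simp)
    then show ?thesis using i g(1) conjugacy_class_self by simp
  next
    case False
    then show ?thesis using coset_subset_conjugacy_class[OF g(1)] h(1) by blast
  qed
  have coset: "set_augmentation (D #> g) \<alpha> = partial_augmentation G \<alpha> g"
    if g: "g \<in> carrier G" "partial_augmentation G \<alpha> g \<noteq> 0" for g
  proof -
    have sub: "conjugacy_class G g \<subseteq> D #> g"
      using conj_mem_coset_D[OF _ g(1)] by (auto simp: conjugacy_class_def mem_coset_D)
    let ?V = "(D #> g) - conjugacy_class G g"
    have "conj_closed ?V"
      by (intro conj_closed_Diff coset_D_conj_closed conj_closed_conjugacy_class g(1))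
    then have "set_augmentation ?V \<alpha> = 0"
      using same_class[OF g] by (intro set_augmentation_zero_if_partial_augmentations_zero[OF \<alpha>]) auto
    then show ?thesis by (simp add: set_augmentation_Diff[OF sub] partial_augmentation_eq)
  qed
  obtain g0 where g0: "g0 \<in> carrier G"
    "\<And>h. h \<in> carrier G \<Longrightarrow> set_augmentation (D #> h) \<alpha> \<noteq> 0 \<longleftrightarrow> h \<in> D #> g0"
    using unique_derived_coset[OF \<alpha> n] by blast
  have "set_augmentation (D #> g0) \<alpha> \<noteq> 0"
    using g0 rcos_self[OF g0(1) D.subgroup_axioms] by blast
  \<comment> \<open>A nonzero sum over the coset forces a nonzero partial augmentation at one of its
    elements.\<close>
  then obtain g where g: "g \<in> D #> g0" "partial_augmentation G \<alpha> g \<noteq> 0"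
    using set_augmentation_zero_if_partial_augmentations_zero[OF \<alpha> coset_D_conj_closed[OF g0(1)]] by blast
  have gG: "g \<in> carrier G" using g(1) g0(1) zpow by (auto simp: mem_coset_D)
  have "h \<in> conjugacy_class G g" if h: "h \<in> carrier G" "partial_augmentation G \<alpha> h \<noteq> 0" for h
  proof -
    have "h \<in> D #> g0" using coset[OF h] g0(2)[OF h(1)] h(2) by simp
    moreover have "D #> g0 = D #> g" using repr_independence[OF g(1) g0(1) D.subgroup_axioms] .
    ultimately show ?thesis using same_class[OF gG g(2) _ h(2)] by simp
  qed
  then show ?thesis unfolding unique_trace_def using gG g(2) by blast
qed

end

theorem theorem3p7:
  fixes G :: "('a, 'm) monoid_scheme"
  assumes "group G"
    and "cyclic_group (G\<lparr>carrier := derived G (carrier G)\<rparr>)"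
    and "infinite (derived G (carrier G))"
  shows "UT_group G"
proof -
  interpret group G by fact
  let ?D = "derived G (carrier G)"
  have D: "subgroup ?D G" by (rule derived_is_subgroup) simp
  interpret S: group "G\<lparr>carrier := ?D\<rparr>" by (rule subgroup_imp_group[OF D])
  obtain z where z: "z \<in> ?D" "?D = range (\<lambda>i::int. z [^]\<^bsub>G\<lparr>carrier := ?D\<rparr>\<^esub> i)"
    using assms(2) by (auto simp: S.cyclic_group)
  then have range: "?D = range (\<lambda>i::int. z [^]\<^bsub>G\<^esub> i)"
    using int_pow_consistent[OF D z(1)] by simp
  have zG: "z \<in> carrier G" using z(1) subgroup.subset[OF D] by blast
  \<comment> \<open>If \<open>z\<close> had finite order, exponents could be reduced modulo
    \<open>\<bar>i\<bar>\<close> and \<open>D\<close> would be finite.\<close>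
  have "i = 0" if "z [^]\<^bsub>G\<^esub> i = \<one>\<^bsub>G\<^esub>" for i :: int
  proof (rule ccontr)
    assume "i \<noteq> 0"
    have "z [^]\<^bsub>G\<^esub> j \<in> (\<lambda>j. z [^]\<^bsub>G\<^esub> j) ` {0..<\<bar>i\<bar>}" for j :: int
    proof -
      have "z [^]\<^bsub>G\<^esub> j = z [^]\<^bsub>G\<^esub> (\<bar>i\<bar> * (j div \<bar>i\<bar>) + j mod \<bar>i\<bar>)" by simp
      also have "\<dots> = (z [^]\<^bsub>G\<^esub> \<bar>i\<bar>) [^]\<^bsub>G\<^esub> (j div \<bar>i\<bar>) \<otimes>\<^bsub>G\<^esub> z [^]\<^bsub>G\<^esub> (j mod \<bar>i\<bar>)"
        using zG by (simp only: int_pow_mult int_pow_pow)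
      also have "z [^]\<^bsub>G\<^esub> \<bar>i\<bar> = \<one>\<^bsub>G\<^esub>" using that zG by (simp add: abs_if int_pow_neg)
      finally show ?thesis using zG \<open>i \<noteq> 0\<close> by simp
    qed
    then have "range (\<lambda>j::int. z [^]\<^bsub>G\<^esub> j) \<subseteq> (\<lambda>j. z [^]\<^bsub>G\<^esub> j) ` {0..<\<bar>i\<bar>}"
      by (rule image_subsetI)
    with range have "finite ?D" by (metis finite_atLeastLessThan_int finite_imageI finite_subset)
    then show False using assms(3) by contradiction
  qed
  then interpret infinite_cyclic_derived G z
    using zG range by unfold_locales auto
  show ?thesis
    unfolding UT_group_def
  proof (intro conjI ballI impI)
    fix \<alpha>
    assume \<alpha>: "\<alpha> \<in> carrier (normalized_units G)"
      and "\<exists>n::nat. n > 0 \<and> \<alpha> [^]\<^bsub>normalized_units G\<^esub> n = \<one>\<^bsub>normalized_units G\<^esub>"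
    then obtain n :: nat where n: "n > 0" "\<alpha> [^]\<^bsub>normalized_units G\<^esub> n = \<one>\<^bsub>normalized_units G\<^esub>" by blast
    have "\<alpha> [^]\<^bsub>integral_group_ring G\<^esub> n = \<one>\<^bsub>integral_group_ring G\<^esub>"
      using n(2) by (simp add: nat_pow_def normalized_units_def units_of_def)
    moreover have "Poly_Mapping.keys \<alpha> \<subseteq> carrier G"
      using \<alpha> by (simp add: normalized_units_def Units_def integral_group_ring_def)
    ultimately show "unique_trace G \<alpha>" using unique_trace_if_torsion n(1) by blast
  qed fact
qed

end
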